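(* Let $M\in\mathbb{R}^{n\times n}$ have rank $r$ and let $\Omega\subseteq\{1,\dots,n\}\times\{1,\dots,n\}$. The following statements are equivalent: 1. $T_{\mathcal{A}_\Omega}(M)\cap T_{\mathcal{M}_r}(M)=\{0\}$. 2. $\operatorname{Rowspace}(T_M^{\Omega^c})\subseteq\operatorname{Rowspace}(T_M^{\Omega})$. 3. $\operatorname{Rank}(T_M^{\Omega})=2nr-r^2$. 4. The $|\Omega|\times|\Omega|$ matrix $V^\Omega(M)$, with rows and columns indexed by $\Omega$, defined by $$V^{\Omega}_{(i_1,j_1),(i_2,j_2)}(M)=\begin{cases}0 & i_1\ne i_2\text{ and }j_1\ne j_2\\ \langle M_{j_1},M_{j_2}\rangle & i_1=i_2\text{ and }j_1\neq j_2\\ \langle M^{i_1},M^{i_2}\rangle & i_1\ne i_2\text{ and }j_1=j_2\\ \|M^{i_1}\|^2+\|M_{j_1}\|^2 & i_1=i_2\text{ and }j_1=j_2\end{cases}$$ has rank $2nr-r^2$.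
   Context: $M_j$ denotes the $j$-th column and $M^i$ the $i$-th row of $M$. $\mathcal{M}_r\subset\mathbb{R}^{n\times n}$ is the manifold of $n\times n$ real matrices of rank exactly $r$; $\mathcal{A}_\Omega=\{X\in\mathbb{R}^{n\times n}: X_{ij}=M_{ij}\ \forall (i,j)\in\Omega\}$. The tangent spaces at $M$ are the linear subspaces $T_{\mathcal{A}_\Omega}(M)=\{X: X_{ij}=0\ \forall (i,j)\in\Omega\}$ and $T_{\mathcal{M}_r}(M)=\{XM+MY: X,Y\in\mathbb{R}^{n\times n}\}$. $T_M$ is the $n^2\times 2n^2$ matrix of the linear map $(X,Y)\mapsto XM+MY$, where the input is the stacked vector $((X^1)^\top,\dots,(X^n)^\top,Y_1,\dots,Y_n)$ (rows of $X$ followed by columns of $Y$): its row indexed by $(i,j)\in\{1,\dots,n\}^2$ consists of $2n$ blocks of size $1\times n$, with $M_j^\top$ in block $i$, $M^i$ in block $n+j$, and zeros in all other blocks. $T_M^{\Omega}$ and $T_M^{\Omega^c}$ are the submatrices of $T_M$ consisting of the rows indexed by $\Omega$ and by its complement $\Omega^c$, respectively. *)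

theory Defs
  imports "HOL-Analysis.Analysis"
begin

text \<open>
  The entry of a matrix \<open>M\<close> in row \<open>i\<close> and column \<open>j\<close> is \<open>M $ i $ j\<close>.
  \<open>tangent_A \<Omega>\<close> is the tangent space of the affine space of matrices that agree with \<open>M\<close> on
  \<open>\<Omega>\<close>, the same at every point; \<open>tangent_M M\<close> is the tangent space at \<open>M\<close> of the manifold
  of matrices of rank \<open>rank M\<close>. Both are defined as explicit linear subspaces.
\<close>

definition tangent_A :: "('n::finite \<times> 'n) set \<Rightarrow> (real^'n^'n) set" where
  "tangent_A \<Omega> = {X. \<forall>(i, j)\<in>\<Omega>. X $ i $ j = 0}"

definition tangent_M :: "real^'n^'n \<Rightarrow> (real^'n::finite^'n) set" where
  "tangent_M M = {X ** M + M ** Y | X Y. True}"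

text \<open>
  Column index \<open>(b, l)\<close> of \<open>T_matrix M\<close> is position \<open>l\<close> inside block \<open>b\<close>. The blocks
  \<open>1, \<dots>, n\<close> (for the rows of \<open>X\<close>) are \<open>Inl k\<close>, the blocks \<open>n+1, \<dots>, 2n\<close> (for the
  columns of \<open>Y\<close>) are \<open>Inr k\<close>.
\<close>

definition T_matrix :: "real^'n^'n \<Rightarrow> real^(('n::finite + 'n) \<times> 'n)^('n \<times> 'n)" where
  "T_matrix M = (\<chi> p c. case (p, c) of
      ((i, j), (Inl k, l)) \<Rightarrow> if k = i then column j M $ l else 0
    | ((i, j), (Inr k, l)) \<Rightarrow> if k = j then row i M $ l else 0)"

definition stack :: "real^'n^'n \<Rightarrow> real^'n^'n \<Rightarrow> real^(('n::finite + 'n) \<times> 'n)" where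
  "stack X Y = (\<chi> c. case c of (Inl k, l) \<Rightarrow> row k X $ l | (Inr k, l) \<Rightarrow> column k Y $ l)"

lemma T_matrix_stack:
  "(T_matrix M *v stack X Y) $ (i, j) = (X ** M + M ** Y) $ i $ j"
proof -
  have "(T_matrix M *v stack X Y) $ (i, j)
      = (\<Sum>b\<in>UNIV. \<Sum>l\<in>UNIV. T_matrix M $ (i, j) $ (b, l) * stack X Y $ (b, l))"
    by (simp add: matrix_vector_mult_def sum.cartesian_product UNIV_Times_UNIV split_def
        del: UNIV_sum)
  also have "\<dots> = (\<Sum>k\<in>UNIV. \<Sum>l\<in>UNIV. T_matrix M $ (i, j) $ (Inl k, l) * stack X Y $ (Inl k, l))
      + (\<Sum>k\<in>UNIV. \<Sum>l\<in>UNIV. T_matrix M $ (i, j) $ (Inr k, l) * stack X Y $ (Inr k, l))"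
    by (simp add: UNIV_Plus_UNIV[symmetric] sum.Plus del: UNIV_Plus_UNIV)
  also have "(\<Sum>k\<in>UNIV. \<Sum>l\<in>UNIV. T_matrix M $ (i, j) $ (Inl k, l) * stack X Y $ (Inl k, l))
      = (\<Sum>k\<in>UNIV. if k = i then \<Sum>l\<in>UNIV. M $ l $ j * X $ k $ l else 0)"
    by (intro sum.cong) (auto simp: T_matrix_def stack_def row_def column_def)
  also have "(\<Sum>k\<in>UNIV. \<Sum>l\<in>UNIV. T_matrix M $ (i, j) $ (Inr k, l) * stack X Y $ (Inr k, l))
      = (\<Sum>k\<in>UNIV. if k = j then \<Sum>l\<in>UNIV. M $ i $ l * Y $ l $ k else 0)"
    by (intro sum.cong) (auto simp: T_matrix_def stack_def row_def column_def)
  finally show ?thesis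
    by (simp add: matrix_matrix_mult_def mult.commute)
qed

text \<open>
  A submatrix on the row set \<open>I\<close> and column set \<open>J\<close> cannot have index types depending on \<open>I\<close>
  and \<open>J\<close>. It is represented by a matrix of the original format, with the entries outside
  \<open>I \<times> J\<close> set to zero. The lemmas \<open>rank_submatrix\<close> and \<open>rowspace_submatrix\<close> show that this
  has the rank and the row space of the genuine \<open>card I \<times> card J\<close> matrix.
\<close>

definition submatrix :: "'m::finite set \<Rightarrow> 'k::finite set \<Rightarrow> real^'k^'m \<Rightarrow> real^'k^'m" where
  "submatrix I J A = (\<chi> i j. if i \<in> I \<and> j \<in> J then A $ i $ j else 0)"

definition rowspace :: "real^'k^'m \<Rightarrow> (real^'k) set" where
  "rowspace A = span (rows A)"

lemma rowspace_submatrix_eq_span: "rowspace (submatrix I UNIV A) = span ((\<lambda>i. row i A) ` I)"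
proof -
  have "rows (submatrix I UNIV A) \<subseteq> insert 0 ((\<lambda>i. row i A) ` I)"
  proof
    fix v assume "v \<in> rows (submatrix I UNIV A)"
    then obtain i where "v = row i (submatrix I UNIV A)"
      by (auto simp: rows_def)
    then have "v = (if i \<in> I then row i A else 0)"
      by (simp add: row_def submatrix_def vec_eq_iff)
    then show "v \<in> insert 0 ((\<lambda>i. row i A) ` I)"
      by auto
  qed
  moreover have "(\<lambda>i. row i A) ` I \<subseteq> rows (submatrix I UNIV A)"
    by (force simp: rows_def row_def submatrix_def vec_eq_iff)
  ultimately show ?thesis
    unfolding rowspace_def by (metis span_insert_0 span_mono subset_antisym)
qed

lemma rowspace_submatrix:
  fixes f :: "'a::finite \<Rightarrow> 'm::finite" and A :: "real^'k::finite^'m"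
  assumes "bij_betw f UNIV I"
  shows "rowspace (submatrix I UNIV A) = rowspace (\<chi> a j. A $ f a $ j)"
proof -
  have "rows (\<chi> a j. A $ f a $ j) = (\<lambda>i. row i A) ` I"
    using assms by (auto simp: rows_def row_def bij_betw_def image_iff)
  then show ?thesis
    by (simp add: rowspace_submatrix_eq_span) (simp add: rowspace_def)
qed

lemma rank_submatrix:
  fixes f :: "'a::finite \<Rightarrow> 'm::finite" and g :: "'b::finite \<Rightarrow> 'k::finite"
    and A :: "real^'k^'m"
  assumes f: "bij_betw f UNIV I" and g: "bij_betw g UNIV J"
  shows "rank (submatrix I J A) = rank (\<chi> a b. A $ f a $ g b)"
proof -
  define E where
    "E v = (\<chi> j. if j \<in> J then v $ the_inv_into UNIV g j else 0)" for v :: "real^'b"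
  have gi: "the_inv_into UNIV g (g b) = b" for b
    using g by (simp add: bij_betw_def the_inv_into_f_f)
  have gJ: "g b \<in> J" for b
    using g by (auto simp: bij_betw_def)
  have lin: "linear E"
    by (rule linearI) (auto simp: E_def vec_eq_iff)
  have "E v $ g b = v $ b" for v b
    by (simp add: E_def gi gJ)
  then have inj: "inj E"
    by (metis injI vec_eq_iff)
  define R where "R = rows (\<chi> a b. A $ f a $ g b)"
  have ER: "E (row a (\<chi> a b. A $ f a $ g b)) = row (f a) (submatrix I J A)" for a
  proof -
    have "f a \<in> I"
      using f by (auto simp: bij_betw_def)
    moreover have "g (the_inv_into UNIV g j) = j" if "j \<in> J" for j
      using g that by (simp add: bij_betw_def f_the_inv_into_f)
    ultimately show ?thesis
      by (simp add: E_def row_def submatrix_def vec_eq_iff)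
  qed
  have "E ` R = (\<lambda>i. row i (submatrix I J A)) ` I"
  proof -
    have "E ` R = range (\<lambda>a. E (row a (\<chi> a b. A $ f a $ g b)))"
      by (auto simp: R_def rows_def)
    also have "\<dots> = (\<lambda>i. row i (submatrix I J A)) ` range f"
      unfolding ER by auto
    finally show ?thesis
      using f by (simp add: bij_betw_def)
  qed
  moreover have "rows (submatrix I J A) \<subseteq> insert 0 ((\<lambda>i. row i (submatrix I J A)) ` I)"
  proof
    fix v assume "v \<in> rows (submatrix I J A)"
    then obtain i where i: "v = row i (submatrix I J A)"
      by (auto simp: rows_def)
    then have "v = 0" if "i \<notin> I"
      using that by (simp add: row_def submatrix_def vec_eq_iff)
    with i show "v \<in> insert 0 ((\<lambda>i. row i (submatrix I J A)) ` I)"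
      by blast
  qed
  moreover have "(\<lambda>i. row i (submatrix I J A)) ` I \<subseteq> rows (submatrix I J A)"
    by (auto simp: rows_def)
  ultimately have "span (rows (submatrix I J A)) = span (E ` R)"
    by (metis span_insert_0 span_mono subset_antisym)
  then have "dim (rows (submatrix I J A)) = dim (E ` R)"
    by (metis dim_span)
  also have "\<dots> = dim R"
    using lin inj by (metis dim_image_eq inj_on_subset subset_UNIV)
  finally show ?thesis
    by (simp add: row_rank_def R_def)
qed

definition V_matrix :: "('n::finite \<times> 'n) set \<Rightarrow> real^'n^'n \<Rightarrow> real^('n \<times> 'n)^('n \<times> 'n)" where
  "V_matrix \<Omega> M = submatrix \<Omega> \<Omega> (\<chi> p q. case (p, q) of ((i1, j1), (i2, j2)) \<Rightarrow>
      if i1 \<noteq> i2 \<and> j1 \<noteq> j2 then 0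
      else if i1 = i2 \<and> j1 \<noteq> j2 then column j1 M \<bullet> column j2 M
      else if i1 \<noteq> i2 \<and> j1 = j2 then row i1 M \<bullet> row i2 M
      else (norm (row i1 M))\<^sup>2 + (norm (column j1 M))\<^sup>2)"

end

theory Submission
  imports Defs
begin

text \<open>
  A row space is the orthogonal complement of the kernel, so (1) and (2) both say that
  \<open>ker T\<^sup>\<Omega> \<subseteq> ker T\<close>. Since the rows of \<open>T\<close> split into those indexed by \<open>\<Omega>\<close> and by its
  complement, (2) says that \<open>T\<^sup>\<Omega>\<close> has the rank of \<open>T\<close>. That rank is \<open>n\<^sup>2 - (n - r)\<^sup>2 = 2nr - r\<^sup>2\<close>:
  the kernel of the transpose of \<open>T\<close> consists of the matrices \<open>Z\<close> with \<open>MZ\<^sup>T = 0\<close> and \<open>M\<^sup>TZ = 0\<close>,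
  and this is the tensor product of \<open>ker M\<^sup>T\<close> and \<open>ker M\<close>. Finally \<open>V\<^sup>\<Omega>\<close> is the Gram matrix of
  the rows of \<open>T\<^sup>\<Omega>\<close>, and a Gram matrix has the rank of its family of vectors.
\<close>

section \<open>Row spaces, kernels and Gram matrices\<close>

lemma orthogonal_comp_rowspace:
  fixes A :: "real^'k^'m"
  shows "(rowspace A)\<^sup>\<bottom> = {x. A *v x = 0}"
proof (intro set_eqI iffI)
  fix x assume "x \<in> (rowspace A)\<^sup>\<bottom>"
  then have "row i A \<bullet> x = 0" for i
    by (auto simp: orthogonal_comp_def orthogonal_def rowspace_def rows_def intro: span_base)
  then show "x \<in> {x. A *v x = 0}"
    by (simp add: vec_eq_iff matrix_vector_mul_component row_def)
next
  fix x assume "x \<in> {x. A *v x = 0}"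
  then show "x \<in> (rowspace A)\<^sup>\<bottom>"
    using orthogonal_nullspace_rowspace[of A x]
    by (auto simp: orthogonal_comp_def rowspace_def orthogonal_commute)
qed

lemma subspace_rowspace: "subspace (rowspace A)"
  by (simp add: rowspace_def)

lemma dim_rowspace: "dim (rowspace A) = rank (A :: real^'k^'m)"
  by (simp add: rowspace_def row_rank_def)

text \<open>Taking orthogonal complements reverses inclusions and is an involution on subspaces, and
  the complement of a row space is the kernel.\<close>

lemma rowspace_subset_iff_nullspace:
  fixes A :: "real^'k^'m" and B :: "real^'k^'l"
  shows "rowspace B \<subseteq> rowspace A \<longleftrightarrow> (\<forall>x. A *v x = 0 \<longrightarrow> B *v x = 0)"
proof -
  have "rowspace B \<subseteq> rowspace A \<longleftrightarrow> (rowspace A)\<^sup>\<bottom> \<subseteq> (rowspace B)\<^sup>\<bottom>"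
    by (metis orthogonal_comp_anti_mono orthogonal_comp_self subspace_rowspace)
  then show ?thesis
    by (auto simp: orthogonal_comp_rowspace)
qed

text \<open>Rank-nullity: the kernel and the row space are orthogonal complements in the whole
  space.\<close>

lemma dim_nullspace:
  fixes A :: "real^'k^'m"
  shows "dim {x. A *v x = 0} + rank A = CARD('k)"
  using dim_subspace_orthogonal_to_vectors[OF subspace_rowspace[of A] subspace_UNIV]
    orthogonal_comp_rowspace[of A]
  by (simp add: dim_rowspace orthogonal_comp_def)

text \<open>Both \<open>A ** transpose A\<close> and \<open>transpose A\<close> have the same
  kernel, so rank-nullity gives them the same rank.\<close>

lemma rank_mult_transpose_self:
  fixes A :: "real^'k^'m"
  shows "rank (A ** transpose A) = rank A"
proof -
  have "(A ** transpose A) *v x = 0 \<longleftrightarrow> transpose A *v x = 0" for x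
  proof
    assume "(A ** transpose A) *v x = 0"
    \<comment> \<open>Pairing with \<open>x\<close> turns the product into the squared norm of
      \<open>transpose A *v x\<close>.\<close>
    then have "x \<bullet> (A *v (transpose A *v x)) = 0"
      by (metis inner_zero_right matrix_vector_mul_assoc)
    then have "(transpose A *v x) \<bullet> (transpose A *v x) = 0"
      by (metis dot_lmul_matrix transpose_matrix_vector)
    then show "transpose A *v x = 0"
      by simp
  qed (simp flip: matrix_vector_mul_assoc)
  then have "rank (A ** transpose A) = rank (transpose A)"
    using dim_nullspace[of "A ** transpose A"] dim_nullspace[of "transpose A"] by simp
  then show ?thesis
    by (simp add: rank_transpose)
qed

section \<open>Tensor products of subspaces\<close>

text \<open>The pure tensor of \<open>u\<close> and \<open>v\<close>, flattened to a vector over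
  index pairs so that it has the type of the vectors that \<open>transpose (T_matrix M)\<close> acts
  on.\<close>

definition outer :: "real^'m \<Rightarrow> real^'k \<Rightarrow> real^('m::finite \<times> 'k::finite)" where
  "outer u v = (\<chi> p. u $ fst p * v $ snd p)"

lemma linear_outer: "linear (outer u)"
  by (rule linearI) (auto simp: outer_def vec_eq_iff algebra_simps)

lemma inner_outer: "outer u v \<bullet> outer u' v' = (u \<bullet> u') * (v \<bullet> v')"
proof -
  have "outer u v \<bullet> outer u' v' = (\<Sum>(i, j)\<in>UNIV \<times> UNIV. (u $ i * u' $ i) * (v $ j * v' $ j))"
    by (simp add: inner_vec_def outer_def split_def mult_ac)
  also have "\<dots> = (u \<bullet> u') * (v \<bullet> v')"
    by (simp add: inner_vec_def sum_product sum.cartesian_product)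
  finally show ?thesis .
qed

text \<open>The set is the tensor product of \<open>U\<close> and \<open>V\<close>: the outer
  products of two orthonormal bases form an orthonormal basis of it.\<close>

lemma dim_matrices_rows_columns_in:
  fixes U :: "(real^'m) set" and V :: "(real^'k) set"
  assumes U: "subspace U" and V: "subspace V"
  shows "dim {z :: real^('m::finite \<times> 'k::finite).
      (\<forall>j. (\<chi> i. z $ (i, j)) \<in> U) \<and> (\<forall>i. (\<chi> j. z $ (i, j)) \<in> V)} = dim U * dim V"
    (is "dim ?S = _")
proof -
  obtain B where B: "B \<subseteq> U" "pairwise orthogonal B" "\<And>u. u \<in> B \<Longrightarrow> norm u = 1"
    "independent B" "card B = dim U" "span B = U"
    using orthonormal_basis_subspace[OF U] by metis
  obtain C where C: "C \<subseteq> V" "pairwise orthogonal C" "\<And>v. v \<in> C \<Longrightarrow> norm v = 1"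
    "independent C" "card C = dim V" "span C = V"
    using orthonormal_basis_subspace[OF V] by metis
  have fB: "finite B"
    using B(4) independent_imp_finite by blast
  have unit: "u \<bullet> u = 1" if "u \<in> B" for u
    using B(3)[OF that] by (simp add: norm_eq_1)
  have unit': "v \<bullet> v = 1" if "v \<in> C" for v
    using C(3)[OF that] by (simp add: norm_eq_1)
  define E where "E = (\<lambda>(u, v). outer u v) ` (B \<times> C)"
  have inner_E: "outer u v \<bullet> outer u' v' = (if u = u' \<and> v = v' then 1 else 0)"
    if "u \<in> B" "v \<in> C" "u' \<in> B" "v' \<in> C" for u v u' v'
    using that B(2) C(2) unit unit' by (auto simp: inner_outer pairwise_def orthogonal_def)
  have inj: "inj_on (\<lambda>(u, v). outer u v) (B \<times> C)"
  proof (rule inj_onI, clarify)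
    fix u v u' v' assume *: "u \<in> B" "v \<in> C" "u' \<in> B" "v' \<in> C" "outer u v = outer u' v'"
    then have "outer u v \<bullet> outer u' v' = 1"
      using inner_E[of u v u v] by simp
    then show "u = u' \<and> v = v'"
      using inner_E[of u v u' v'] * by (metis zero_neq_one)
  qed
  have "pairwise orthogonal E"
    unfolding pairwise_def E_def orthogonal_def by (auto simp: inner_E split: if_splits)
  moreover have "0 \<notin> E"
    by (auto simp: E_def) (metis inner_E inner_zero_left zero_neq_one)
  ultimately have indep: "independent E"
    by (rule pairwise_orthogonal_independent)
  have sub: "E \<subseteq> ?S"
  proof -
    have "(\<chi> i. outer u v $ (i, j)) = v $ j *\<^sub>R u" "(\<chi> j. outer u v $ (i, j)) = u $ i *\<^sub>R v"
      for u :: "real^'m" and v :: "real^'k" and i j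
      by (simp_all add: outer_def vec_eq_iff)
    then show ?thesis
      using B(1) C(1) U V by (auto simp: E_def intro!: subspace_scale)
  qed
  have span: "?S \<subseteq> span E"
  proof
    fix z assume z: "z \<in> ?S"
    \<comment> \<open>Expanding every column of \<open>z\<close> in the basis \<open>B\<close> gives \<open>z = (\<Sum>u\<in>B. outer u (w u))\<close>, where
      \<open>w u\<close> lies in \<open>V\<close> as a combination of the rows of \<open>z\<close>.\<close>
    define w where "w u = (\<chi> j. (\<chi> i. z $ (i, j)) \<bullet> u)" for u
    have "w u = (\<Sum>i\<in>UNIV. u $ i *\<^sub>R (\<chi> j. z $ (i, j)))" for u
      by (simp add: w_def vec_eq_iff inner_vec_def mult.commute)
    then have w: "w u \<in> span C" for u
      using z V C(6) by (auto intro!: subspace_sum subspace_scale)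
    have "outer u (w u) \<in> span E" if "u \<in> B" for u
    proof -
      \<comment> \<open>By linearity \<open>outer u\<close> maps the span of \<open>C\<close> onto
        the span of its image.\<close>
      have "outer u (w u) \<in> span (outer u ` C)"
        using w linear_span_image[OF linear_outer, of u C] by blast
      moreover have "outer u ` C \<subseteq> E"
        using that by (auto simp: E_def)
      ultimately show ?thesis
        using span_mono by blast
    qed
    then have "(\<Sum>u\<in>B. outer u (w u)) \<in> span E"
      by (rule span_sum)
    moreover have "z = (\<Sum>u\<in>B. outer u (w u))"
    proof -
      have "z $ (i, j) = (\<Sum>u\<in>B. outer u (w u) $ (i, j))" for i j
      proof -
        have "(\<chi> i. z $ (i, j)) = (\<Sum>u\<in>B. ((\<chi> i. z $ (i, j)) \<bullet> u) *\<^sub>R u)"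
          using orthonormal_basis_expand[OF B(2) B(3) _ fB] z B(6) by simp
        then have "(\<chi> i. z $ (i, j)) $ i = (\<Sum>u\<in>B. ((\<chi> i. z $ (i, j)) \<bullet> u) *\<^sub>R u) $ i"
          by (rule arg_cong)
        then show ?thesis
          by (simp add: outer_def w_def mult.commute)
      qed
      then show ?thesis
        by (simp add: vec_eq_iff)
    qed
    ultimately show "z \<in> span E"
      by simp
  qed
  have "dim ?S = card E"
    by (rule basis_card_eq_dim[OF sub span indep, symmetric])
  also have "\<dots> = dim U * dim V"
    using inj B(5) C(5) by (simp add: E_def card_image card_cartesian_product)
  finally show ?thesis .
qed

section \<open>The rank of \<open>T_matrix M\<close>\<close>

text \<open>Read \<open>z\<close> as a matrix: block \<open>Inl k\<close> of the product is
  \<open>M\<close> applied to row \<open>k\<close> of \<open>z\<close>, and block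
  \<open>Inr k\<close> is \<open>transpose M\<close> applied to column \<open>k\<close>.\<close>

lemma nullspace_transpose_T_matrix:
  fixes M :: "real^'n::finite^'n"
  shows "transpose (T_matrix M) *v z = 0 \<longleftrightarrow>
    (\<forall>j. transpose M *v (\<chi> i. z $ (i, j)) = 0) \<and> (\<forall>i. M *v (\<chi> j. z $ (i, j)) = 0)"
proof -
  have sum_pair: "(\<Sum>p\<in>UNIV. f p) = (\<Sum>i\<in>UNIV. \<Sum>j\<in>UNIV. f (i, j))" for f :: "'n \<times> 'n \<Rightarrow> real"
    by (simp add: sum.cartesian_product)
  have if_out: "(\<Sum>j\<in>UNIV. (if k = i then f j else 0) * g j) = (if k = i then \<Sum>j\<in>UNIV. f j * g j else 0)"
    for f g :: "'n \<Rightarrow> real" and k i :: 'n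
    by simp
  have Inl: "(transpose (T_matrix M) *v z) $ (Inl k, l) = (M *v (\<chi> j. z $ (k, j))) $ l" for k l
    by (simp add: matrix_vector_mult_def transpose_def T_matrix_def column_def sum_pair if_out
        del: transpose_matrix_vector)
  have Inr: "(transpose (T_matrix M) *v z) $ (Inr k, l)
      = (transpose M *v (\<chi> i. z $ (i, k))) $ l" for k l
    by (simp add: matrix_vector_mult_def transpose_def T_matrix_def row_def sum_pair
        if_distrib[of "\<lambda>x. x * _"] cong: if_cong del: transpose_matrix_vector)
  have all_split: "(\<forall>c. P c) \<longleftrightarrow> (\<forall>k l. P (Inl k, l)) \<and> (\<forall>k l. P (Inr k, l))"
    for P :: "('n + 'n) \<times> 'n \<Rightarrow> bool"
    by (metis surj_pair sum.exhaust)
  show ?thesis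
    unfolding vec_eq_iff all_split Inl Inr zero_index by blast
qed

text \<open>The left kernel is a tensor product of two spaces of dimension n - r inside a space of
  dimension n * n. Working in \<open>int\<close> avoids truncated subtraction.\<close>

lemma rank_T_matrix:
  fixes M :: "real^'n::finite^'n"
  shows "int (rank (T_matrix M)) = 2 * int CARD('n) * int (rank M) - (int (rank M))\<^sup>2"
proof -
  have sub: "subspace {x. A *v x = 0}" for A :: "real^'n^'n"
    by (metis orthogonal_comp_rowspace subspace_orthogonal_comp)
  have M: "int (dim {x. M *v x = 0}) = int CARD('n) - int (rank M)"
    using dim_nullspace[of M] by linarith
  have Mt: "int (dim {x. transpose M *v x = 0}) = int CARD('n) - int (rank M)"
    using dim_nullspace[of "transpose M"] by (simp add: rank_transpose)
  have "dim {z. transpose (T_matrix M) *v z = 0}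
      = dim {x. transpose M *v x = 0} * dim {x. M *v x = 0}"
    using dim_matrices_rows_columns_in[OF sub[of "transpose M"] sub[of M]]
    by (simp add: nullspace_transpose_T_matrix del: transpose_matrix_vector)
  then have "int (dim {z. transpose (T_matrix M) *v z = 0}) = (int CARD('n) - int (rank M))\<^sup>2"
    by (simp add: M Mt power2_eq_square del: transpose_matrix_vector)
  moreover have "dim {z. transpose (T_matrix M) *v z = 0} + rank (T_matrix M) = CARD('n) * CARD('n)"
    using dim_nullspace[of "transpose (T_matrix M)"] by (simp add: rank_transpose)
  then have "int (dim {z. transpose (T_matrix M) *v z = 0}) + int (rank (T_matrix M))
      = int CARD('n) * int CARD('n)"
    by (metis of_nat_add of_nat_mult)
  ultimately show ?thesis
    by (simp add: power2_eq_square algebra_simps)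
qed

section \<open>Tangent spaces, row spaces and rank\<close>

lemma submatrix_vector_mult:
  "(submatrix I UNIV A *v x) $ i = (if i \<in> I then (A *v x) $ i else 0)"
  by (simp add: submatrix_def matrix_vector_mult_def)

lemma stack_surj: "\<exists>X Y. v = stack X Y"
proof -
  \<comment> \<open>The second witness has its indices swapped because \<open>stack\<close> reads
    \<open>Y\<close> by columns.\<close>
  have "v = stack (\<chi> k l. v $ (Inl k, l)) (\<chi> l k. v $ (Inr k, l))"
    by (auto simp: stack_def vec_eq_iff row_def column_def split: sum.split)
  then show ?thesis
    by blast
qed

lemma tangent_Int_trivial_iff_nullspace:
  "tangent_A \<Omega> \<inter> tangent_M M = {0} \<longleftrightarrow>
    (\<forall>v. submatrix \<Omega> UNIV (T_matrix M) *v v = 0 \<longrightarrow> submatrix (- \<Omega>) UNIV (T_matrix M) *v v = 0)"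
proof -
  have inA: "submatrix \<Omega> UNIV (T_matrix M) *v stack X Y = 0 \<longleftrightarrow> X ** M + M ** Y \<in> tangent_A \<Omega>"
    for X Y
    by (auto simp: vec_eq_iff submatrix_vector_mult T_matrix_stack tangent_A_def
        simp del: vector_add_component)
  \<comment> \<open>The entries on \<Omega> vanish by assumption, so only those on the complement
    remain to be tested.\<close>
  have zero: "submatrix (- \<Omega>) UNIV (T_matrix M) *v stack X Y = 0 \<longleftrightarrow> X ** M + M ** Y = 0"
    if "X ** M + M ** Y \<in> tangent_A \<Omega>" for X Y
    using that by (auto simp: vec_eq_iff submatrix_vector_mult T_matrix_stack tangent_A_def
        simp del: vector_add_component)
  have "M ** 0 = 0" "0 ** M = 0"
    by (simp_all add: vec_eq_iff matrix_matrix_mult_def)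
  then have "0 \<in> tangent_M M"
    unfolding tangent_M_def by (metis (mono_tags, lifting) add_0 mem_Collect_eq)
  moreover have "0 \<in> tangent_A \<Omega>"
    by (auto simp: tangent_A_def)
  ultimately have "tangent_A \<Omega> \<inter> tangent_M M = {0} \<longleftrightarrow>
      (\<forall>Z\<in>tangent_M M. Z \<in> tangent_A \<Omega> \<longrightarrow> Z = 0)"
    by blast
  also have "\<dots> \<longleftrightarrow> (\<forall>X Y. X ** M + M ** Y \<in> tangent_A \<Omega> \<longrightarrow> X ** M + M ** Y = 0)"
    by (auto simp: tangent_M_def)
  also have "\<dots> \<longleftrightarrow> (\<forall>X Y. submatrix \<Omega> UNIV (T_matrix M) *v stack X Y = 0 \<longrightarrow>
      submatrix (- \<Omega>) UNIV (T_matrix M) *v stack X Y = 0)"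
    using inA zero by blast
  also have "\<dots> \<longleftrightarrow> (\<forall>v. submatrix \<Omega> UNIV (T_matrix M) *v v = 0 \<longrightarrow>
      submatrix (- \<Omega>) UNIV (T_matrix M) *v v = 0)"
    by (metis stack_surj)
  finally show ?thesis .
qed

text \<open>The two sets of rows together span the row space of \<open>A\<close>, so the inclusion
  says that the rows in \<open>I\<close> already span it. For nested subspaces, equality amounts to
  equal dimension.\<close>

lemma rowspace_submatrix_Compl_subset_iff:
  fixes A :: "real^'k::finite^'m::finite"
  shows "rowspace (submatrix (- I) UNIV A) \<subseteq> rowspace (submatrix I UNIV A) \<longleftrightarrow>
    rank (submatrix I UNIV A) = rank A"
proof -
  have sub: "rowspace (submatrix I UNIV A) \<subseteq> rowspace A"
    unfolding rowspace_submatrix_eq_span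
    by (auto simp: rowspace_def rows_def intro!: span_mono)
  have "rowspace A = span ((\<lambda>i. row i A) ` I \<union> (\<lambda>i. row i A) ` (- I))"
    by (auto simp: rowspace_def rows_def intro!: arg_cong[where f = span])
  then have "rowspace (submatrix (- I) UNIV A) \<subseteq> rowspace (submatrix I UNIV A) \<longleftrightarrow>
      rowspace (submatrix I UNIV A) = rowspace A"
    unfolding rowspace_submatrix_eq_span
    by (smt (verit, ccfv_SIG) Un_subset_iff span_minimal span_superset span_mono subspace_span
        subset_trans subset_antisym sup_ge1 sup_ge2)
  also have "\<dots> \<longleftrightarrow> rank (submatrix I UNIV A) = rank A"
    using sub subspace_dim_equal[OF subspace_rowspace subspace_rowspace sub]
    by (metis dim_rowspace order_refl)
  finally show ?thesis .
qed

section \<open>The Gram matrix of the rows of \<open>T_matrix M\<close>\<close>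

text \<open>Row \<open>(i, j)\<close> is supported on the blocks \<open>Inl i\<close> and
  \<open>Inr j\<close>, so two rows overlap in a block only when the corresponding indices
  agree.\<close>

lemma T_matrix_row_inner:
  fixes M :: "real^'n::finite^'n"
  shows "T_matrix M $ (i1, j1) \<bullet> T_matrix M $ (i2, j2)
    = (if i1 = i2 then column j1 M \<bullet> column j2 M else 0)
      + (if j1 = j2 then row i1 M \<bullet> row i2 M else 0)"
proof -
  have split_sum: "(\<Sum>c\<in>UNIV. f c)
      = (\<Sum>k\<in>UNIV. \<Sum>l\<in>UNIV. f (Inl k, l)) + (\<Sum>k\<in>UNIV. \<Sum>l\<in>UNIV. f (Inr k, l))"
    for f :: "('n + 'n) \<times> 'n \<Rightarrow> real"
  proof -
    have "(\<Sum>c\<in>UNIV. f c) = (\<Sum>b\<in>UNIV. \<Sum>l\<in>UNIV. f (b, l))"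
      by (simp add: sum.cartesian_product del: UNIV_sum)
    then show ?thesis
      by (simp add: UNIV_Plus_UNIV[symmetric] sum.Plus del: UNIV_Plus_UNIV)
  qed
  have "(\<Sum>k\<in>UNIV. \<Sum>l\<in>UNIV. (if k = a then f l else 0) * (if k = b then g l else 0))
      = (if a = b then \<Sum>l\<in>UNIV. f l * g l else 0)" for a b :: 'n and f g :: "'n \<Rightarrow> real"
  proof -
    have "(\<Sum>k\<in>UNIV. \<Sum>l\<in>UNIV. (if k = a then f l else 0) * (if k = b then g l else 0))
        = (\<Sum>k\<in>UNIV. if k = a then if a = b then \<Sum>l\<in>UNIV. f l * g l else 0 else 0)"
      by (intro sum.cong) auto
    then show ?thesis
      by simp
  qed
  then show ?thesis
    by (simp add: inner_vec_def split_sum T_matrix_def)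
qed

text \<open>The four cases in \<open>V_matrix\<close> are the values of a sum of two conditional
  inner products, with squared norms as inner products of a vector with itself.\<close>

lemma V_matrix_eq_Gram:
  "V_matrix \<Omega> M = submatrix \<Omega> UNIV (T_matrix M) ** transpose (submatrix \<Omega> UNIV (T_matrix M))"
  (is "_ = ?A ** _")
proof -
  have "(?A ** transpose ?A) $ p $ q = (if p \<in> \<Omega> \<and> q \<in> \<Omega> then T_matrix M $ p \<bullet> T_matrix M $ q else 0)"
    for p q
    by (auto simp: matrix_matrix_mult_def transpose_def submatrix_def inner_vec_def intro: sum.neutral)
  then show ?thesis
    by (auto simp: vec_eq_iff V_matrix_def submatrix_def T_matrix_row_inner power2_norm_eq_inner)
qed

theorem theorem3:
  fixes M :: "real^'n::finite^'n" and r :: nat and \<Omega> :: "('n \<times> 'n) set"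
  assumes "rank M = r"
  shows
    "(tangent_A \<Omega> \<inter> tangent_M M = {0} \<longleftrightarrow>
        rowspace (submatrix (- \<Omega>) UNIV (T_matrix M)) \<subseteq> rowspace (submatrix \<Omega> UNIV (T_matrix M))) \<and>
     (rowspace (submatrix (- \<Omega>) UNIV (T_matrix M)) \<subseteq> rowspace (submatrix \<Omega> UNIV (T_matrix M)) \<longleftrightarrow>
        int (rank (submatrix \<Omega> UNIV (T_matrix M))) = 2 * int CARD('n) * int r - (int r)\<^sup>2) \<and>
     (int (rank (submatrix \<Omega> UNIV (T_matrix M))) = 2 * int CARD('n) * int r - (int r)\<^sup>2 \<longleftrightarrow>
        int (rank (V_matrix \<Omega> M)) = 2 * int CARD('n) * int r - (int r)\<^sup>2)"
proof (intro conjI)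
  show "tangent_A \<Omega> \<inter> tangent_M M = {0} \<longleftrightarrow>
      rowspace (submatrix (- \<Omega>) UNIV (T_matrix M)) \<subseteq> rowspace (submatrix \<Omega> UNIV (T_matrix M))"
    by (simp add: tangent_Int_trivial_iff_nullspace rowspace_subset_iff_nullspace)
  show "rowspace (submatrix (- \<Omega>) UNIV (T_matrix M)) \<subseteq> rowspace (submatrix \<Omega> UNIV (T_matrix M))
      \<longleftrightarrow> int (rank (submatrix \<Omega> UNIV (T_matrix M))) = 2 * int CARD('n) * int r - (int r)\<^sup>2"
    \<comment> \<open>The inclusion becomes equality of rank with the full
      \<open>T_matrix M\<close>, whose rank is the stated number.\<close>
    unfolding rowspace_submatrix_Compl_subset_iff
    using rank_T_matrix[of M] assms by (metis of_nat_eq_iff)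
  show "int (rank (submatrix \<Omega> UNIV (T_matrix M))) = 2 * int CARD('n) * int r - (int r)\<^sup>2 \<longleftrightarrow>
      int (rank (V_matrix \<Omega> M)) = 2 * int CARD('n) * int r - (int r)\<^sup>2"
    by (simp only: V_matrix_eq_Gram rank_mult_transpose_self)
qed

end
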